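(* Let $u:[0,1]\to\mathbb{R}$ be the standard Cantor function. Then, for every $0<\epsilon<1/6$ and every non-negative even function $\rho_\epsilon\in L^1(\mathbb{R})$ with $\operatorname{supp}\rho_\epsilon\subset[-\epsilon,\epsilon]$, $$\int_0^1\left|\int_0^1\frac{u(x)-u(y)}{|x-y|}\rho_\epsilon(x-y)\,dy\right|dx\ \geq\ \frac{1}{36}\int_{3\epsilon/4}^{\epsilon}\rho_\epsilon.$$
   Context: The standard Cantor function is the unique fixed point of the contraction map $T:X\to X$ defined by $$T(v)(x)=\begin{cases}v(3x)/2&\text{if }0\le x\le1/3,\\ 1/2&\text{if }1/3<x<2/3,\\ (v(3x-2)+1)/2&\text{if }2/3\le x\le1,\end{cases}$$ where $X$ is the complete metric space of all continuous functions $v:[0,1]\to\mathbb{R}$ with $v(0)=0$ and $v(1)=1$, equipped with the uniform distance. *)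

theory Defs
  imports "HOL-Analysis.Analysis"
begin

(* Functions on [0,1] are total functions on the reals, made canonical by requiring them to be
   undefined outside [0,1] (extensional); otherwise the fixed point would not be unique. *)
definition cantor_space :: "(real \<Rightarrow> real) set" where
  "cantor_space = {v \<in> extensional {0..1}. continuous_on {0..1} v \<and> v 0 = 0 \<and> v 1 = 1}"

definition cantor_operator :: "(real \<Rightarrow> real) \<Rightarrow> real \<Rightarrow> real" where
  "cantor_operator v = (\<lambda>x\<in>{0..1}.
     if x \<le> 1/3 then v (3 * x) / 2
     else if x < 2/3 then 1/2
     else (v (3 * x - 2) + 1) / 2)"

definition cantor_function :: "real \<Rightarrow> real" where
  "cantor_function = (THE v. v \<in> cantor_space \<and> cantor_operator v = v)"

(* The support of a Lebesgue class: it is invariant under changes on null sets and contained in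
   the closure of {x. f x \<noteq> 0}. *)
definition essential_support :: "(real \<Rightarrow> real) \<Rightarrow> real set" where
  "essential_support f = - \<Union>{U. open U \<and> (AE x in lebesgue. x \<in> U \<longrightarrow> f x = 0)}"

lemma cantor_fixpoint_unique:
  assumes u: "u \<in> cantor_space" "cantor_operator u = u"
    and v: "v \<in> cantor_space" "cantor_operator v = v"
  shows "u = v"
proof -
  have c: "continuous_on {0..1} (\<lambda>x. \<bar>u x - v x\<bar>)"
    using u(1) v(1) by (auto simp: cantor_space_def intro!: continuous_intros)
  obtain m where m: "m \<in> {0..1}" "\<And>x. x \<in> {0..1} \<Longrightarrow> \<bar>u x - v x\<bar> \<le> \<bar>u m - v m\<bar>"
    using continuous_attains_sup[OF _ _ c] by auto
  have eq: "u m = cantor_operator u m" "v m = cantor_operator v m"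
    using u(2) v(2) by simp_all
  have "\<bar>u m - v m\<bar> \<le> \<bar>u m - v m\<bar> / 2"
  proof -
    consider "m \<le> 1/3" | "1/3 < m" "m < 2/3" | "2/3 \<le> m" by linarith
    then show ?thesis
    proof cases
      case 1
      then have "\<bar>u m - v m\<bar> = \<bar>u (3 * m) - v (3 * m)\<bar> / 2"
        using m(1) by (subst eq(1), subst eq(2)) (simp add: cantor_operator_def abs_if)
      then show ?thesis using m(2)[of "3 * m"] m(1) 1 by auto
    next
      case 2
      then have "\<bar>u m - v m\<bar> = 0"
        using m(1) by (subst eq(1), subst eq(2)) (simp add: cantor_operator_def)
      then show ?thesis by simp
    next
      case 3
      then have "\<bar>u m - v m\<bar> = \<bar>u (3 * m - 2) - v (3 * m - 2)\<bar> / 2"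
        using m(1) by (subst eq(1), subst eq(2)) (simp add: cantor_operator_def abs_if field_simps)
      then show ?thesis using m(2)[of "3 * m - 2"] m(1) 3 by auto
    qed
  qed
  then have "u x = v x" if "x \<in> {0..1}" for x
    using m(2)[OF that] by auto
  then show ?thesis
    using u(1) v(1) by (auto simp: cantor_space_def intro: extensionalityI)
qed

lemma cantor_fixpoint_exists:
  "\<exists>v. v \<in> cantor_space \<and> cantor_operator v = v"
proof -
  define S :: "(real \<Rightarrow>\<^sub>C real) set" where
    "S = PiC UNIV (\<lambda>x. if x \<le> 0 then {0} else if 1 \<le> x then {1} else UNIV)"
  define T :: "(real \<Rightarrow>\<^sub>C real) \<Rightarrow> (real \<Rightarrow>\<^sub>C real)" where
    "T f = Bcontfun (\<lambda>x. (f (3 * x) + f (3 * x - 2)) / 2)" for f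
  have S: "f \<in> S \<longleftrightarrow> (\<forall>x\<le>0. f x = 0) \<and> (\<forall>x\<ge>1. f x = 1)" for f
    unfolding S_def mem_PiC_iff by (force simp: Pi_iff)
  have T: "T f x = (f (3 * x) + f (3 * x - 2)) / 2" for f x
  proof -
    have "norm ((f (3 * x) + f (3 * x - 2)) / 2) \<le> norm f" for x
      using norm_bounded[of f "3 * x"] norm_bounded[of f "3 * x - 2"] by auto
    moreover have "continuous_on UNIV (\<lambda>x. (f (3 * x) + f (3 * x - 2)) / 2)"
      by (intro continuous_intros continuous_on_compose2[OF continuous_on_apply_bcontfun]) auto
    ultimately have "(\<lambda>x. (f (3 * x) + f (3 * x - 2)) / 2) \<in> bcontfun"
      by (intro bcontfun_normI)
    then show ?thesis
      by (simp only: T_def Bcontfun_inverse)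
  qed
  have "complete S"
    unfolding S_def complete_eq_closed by (intro closed_PiC) auto
  moreover have "S \<noteq> {}"
  proof -
    have "(\<lambda>x::real. max 0 (min 1 x)) \<in> bcontfun"
      by (rule bcontfun_normI[where b = 1]) (auto intro!: continuous_intros)
    then obtain g :: "real \<Rightarrow>\<^sub>C real" where g: "(\<lambda>x. max 0 (min 1 x)) = apply_bcontfun g"
      by (rule bcontfunE)
    have "g \<in> S" by (simp add: S g[symmetric])
    then show ?thesis by auto
  qed
  moreover have "T ` S \<subseteq> S"
    by (auto simp: S T)
  moreover have "dist (T f) (T g) \<le> 1/2 * dist f g" if "f \<in> S" "g \<in> S" for f g
  proof (rule dist_bound)
    fix x :: real
    consider "x \<le> 2/3" | "1/3 \<le> x" by linarith
    then show "dist (T f x) (T g x) \<le> 1/2 * dist f g"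
    proof cases
      case 1
      with that have "f (3 * x - 2) = g (3 * x - 2)" by (auto simp: S)
      then show ?thesis
        using dist_bounded[of f "3 * x" g] by (simp add: T dist_real_def diff_divide_distrib[symmetric])
    next
      case 2
      with that have "f (3 * x) = g (3 * x)" by (auto simp: S)
      then show ?thesis
        using dist_bounded[of f "3 * x - 2" g] by (simp add: T dist_real_def diff_divide_distrib[symmetric])
    qed
  qed
  ultimately have "\<exists>!f. f \<in> S \<and> T f = f"
    using Banach_fix[of S "1/2" T] by auto
  then obtain f where f: "f \<in> S" "T f = f" by auto
  then have fx: "f x = (f (3 * x) + f (3 * x - 2)) / 2" for x
    using T[of f x] by simp
  define v where "v = restrict (apply_bcontfun f) {0..1}"
  have "continuous_on {0..1} v"
    by (rule continuous_on_eq[OF continuous_on_apply_bcontfun[of _ f]]) (simp add: v_def)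
  then have "v \<in> cantor_space"
    using f(1) by (auto simp: cantor_space_def v_def S)
  moreover have "cantor_operator v = v"
  proof
    fix x
    show "cantor_operator v x = v x"
      using f(1) fx[of x] by (auto simp: cantor_operator_def v_def S)
  qed
  ultimately show ?thesis by blast
qed

lemma cantor_function_fixpoint:
  "cantor_function \<in> cantor_space \<and> cantor_operator cantor_function = cantor_function"
proof -
  obtain v where v: "v \<in> cantor_space" "cantor_operator v = v"
    using cantor_fixpoint_exists by blast
  have "cantor_function = v"
    unfolding cantor_function_def
  proof (rule the_equality)
    show "v \<in> cantor_space \<and> cantor_operator v = v" using v by (rule conjI)
    show "w = v" if "w \<in> cantor_space \<and> cantor_operator w = w" for w
      by (rule cantor_fixpoint_unique[OF conjunct1[OF that] conjunct2[OF that] v])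
  qed
  then show ?thesis
    using v by (simp only:)
qed

end

theory Submission
  imports Defs
begin

text \<open>
  Extend the Cantor function by the constants 0 and 1 to a function \<open>v\<close> on the whole line. There it
  satisfies the single equation \<open>v x = (v (3 x) + v (3 x - 2)) / 2\<close>, from which its monotonicity and
  all values that are needed follow.

  In the inner integral the points \<open>y\<close> on the two sides of \<open>x\<close> contribute with opposite signs, but
  there is no cancellation where \<open>v\<close> is constant on one side. So let the
  plateau set \<open>P\<close> of \<open>\<epsilon>\<close> consist of the \<open>x\<close> with \<open>v (x + \<epsilon>) = v x\<close>. For \<open>x \<in> P\<close> the points within
  distance \<open>\<epsilon>\<close> to the right of \<open>x\<close> contribute nothing, and those to the left contribute
  nonnegatively. Writing \<open>y = x - h\<close> and integrating over \<open>x \<in> P\<close> first, the left-hand side of the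
  theorem is at least the integral over \<open>h\<close> in \<open>[3 \<epsilon> / 4, \<epsilon>]\<close> of \<open>\<rho> h / h\<close> times
  \<open>\<Phi> \<epsilon> h = \<integral>x\<in>P. v x - v (x - h)\<close>, and it remains to show \<open>\<Phi> \<epsilon> h \<ge> h / 36\<close>
  (\<open>integral_plateau_increment_ge\<close>).

  This estimate is scale invariant: the equation for \<open>v\<close> maps two copies of the plateau set of \<open>\<epsilon>\<close>,
  shrunk by the factor 3, into the plateau set of \<open>\<epsilon> / 3\<close> and halves the increments, so that
  \<open>\<Phi> (\<epsilon> / 3) (h / 3) \<ge> 2 * (1/3) * (1/2) * \<Phi> \<epsilon> h\<close> (\<open>integral_plateau_increment_rescale\<close>).
  Hence only \<open>1/18 \<le> \<epsilon> < 1/6\<close> matters, and there the left half of the middle gap \<open>(1/3, 2/3)\<close>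
  lies in \<open>P\<close> and already yields the bound.

  The change of the order of integration, and the fact that the outer integral is finite at all, rest
  on \<open>\<integral>\<bar>v x - v (x - h)\<bar> \<le> \<bar>h\<bar>\<close>, which holds because \<open>v\<close> is monotone with total increment 1
  (\<open>integral_abs_cantor_quotient_le\<close>). The integrand itself cannot be bounded pointwise, since the quotient is
  unbounded near the diagonal.
\<close>

section \<open>The Cantor function on the whole line\<close>

definition cantor_line :: "real \<Rightarrow> real" where
  "cantor_line x = cantor_function (max 0 (min 1 x))"

lemma cantor_line_eq: "x \<in> {0..1} \<Longrightarrow> cantor_line x = cantor_function x"
  by (simp add: cantor_line_def)

lemma cantor_line_left: "x \<le> 0 \<Longrightarrow> cantor_line x = 0"
  using cantor_function_fixpoint by (simp add: cantor_line_def cantor_space_def min_def)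

lemma cantor_line_right: "1 \<le> x \<Longrightarrow> cantor_line x = 1"
  using cantor_function_fixpoint by (simp add: cantor_line_def cantor_space_def)

lemma continuous_cantor_line: "continuous_on A cantor_line"
proof -
  have "continuous_on {0..1} cantor_function"
    using cantor_function_fixpoint by (simp add: cantor_space_def)
  then have "continuous_on A (\<lambda>x. cantor_function (max 0 (min 1 x)))"
    by (rule continuous_on_compose2) (auto intro!: continuous_intros)
  then show ?thesis by (simp add: cantor_line_def[abs_def])
qed

lemma borel_measurable_cantor_line [measurable]: "cantor_line \<in> borel_measurable borel"
  using continuous_cantor_line by (rule borel_measurable_continuous_onI)

text \<open>
  The three cases of the fixed point equation merge into one: at every \<open>x\<close> at least one of the two
  summands takes its value from a constant part of the extension, and in the middle third both do.
\<close>
lemma cantor_line_rescale: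
  "cantor_line x = (cantor_line (3 * x) + cantor_line (3 * x - 2)) / 2"
proof -
  consider "x \<le> 0" | "0 \<le> x" "x \<le> 1/3" | "1/3 < x" "x < 2/3" | "2/3 \<le> x" "x \<le> 1" | "1 \<le> x"
    by linarith
  then show ?thesis
  proof cases
    case 1
    then show ?thesis by (simp add: cantor_line_left)
  next
    case 5
    then show ?thesis by (simp add: cantor_line_right)
  next
    case 2
    then have "cantor_line x = cantor_operator cantor_function x"
      using cantor_function_fixpoint by (simp add: cantor_line_eq)
    with 2 show ?thesis
      by (simp add: cantor_operator_def cantor_line_eq cantor_line_left)
  next
    case 3
    then have "cantor_line x = cantor_operator cantor_function x"
      using cantor_function_fixpoint by (simp add: cantor_line_eq)
    with 3 show ?thesis
      by (simp add: cantor_operator_def cantor_line_left cantor_line_right)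
  next
    case 4
    then have "cantor_line x = cantor_operator cantor_function x"
      using cantor_function_fixpoint by (simp add: cantor_line_eq)
    with 4 show ?thesis
      by (simp add: cantor_operator_def cantor_line_eq cantor_line_right)
  qed
qed

lemma nonpos_if_le_halvings:
  fixes a B :: real
  assumes "\<And>n. a \<le> B / 2 ^ n"
  shows "a \<le> 0"
  using LIMSEQ_le_const[OF LIMSEQ_divide_realpow_zero[of 2 B], of a] assms by auto

text \<open>
  Any bound on the excess of the values beyond \<open>[0, 1]\<close> is halved by one use of the self-similarity,
  since one of the two summands is always 0 or 1; so the excess is zero.
\<close>
lemma cantor_line_nonneg: "0 \<le> cantor_line x" and cantor_line_le_one: "cantor_line x \<le> 1"
proof -
  have "compact (cantor_line ` {0..1})"
    by (intro compact_continuous_image continuous_cantor_line) simp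
  then obtain B where B: "\<And>x. x \<in> {0..1} \<Longrightarrow> \<bar>cantor_line x\<bar> \<le> B"
    using compact_imp_bounded[of "cantor_line ` {0..1}"] unfolding bounded_iff real_norm_def by blast
  have B0: "0 \<le> B" using B[of 0] by simp
  have "-(B / 2 ^ n) \<le> cantor_line x \<and> cantor_line x \<le> 1 + B / 2 ^ n" for n x
  proof (induction n arbitrary: x)
    case 0
    consider "x \<le> 0" | "x \<in> {0..1}" | "1 \<le> x" by fastforce
    then show ?case
      using B0 B[of x] by cases (auto simp: cantor_line_left cantor_line_right)
  next
    case (Suc n)
    define c where "c = B / 2 ^ n"
    have c: "B / 2 ^ Suc n = c / 2" "0 \<le> c" using B0 by (simp_all add: c_def)
    have IH: "- c \<le> cantor_line (3 * x)" "cantor_line (3 * x) \<le> 1 + c"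
      "- c \<le> cantor_line (3 * x - 2)" "cantor_line (3 * x - 2) \<le> 1 + c"
      using Suc.IH[of "3 * x"] Suc.IH[of "3 * x - 2"] by (simp_all add: c_def)
    have double: "2 * cantor_line x = cantor_line (3 * x) + cantor_line (3 * x - 2)"
      using cantor_line_rescale[of x] by simp
    consider "cantor_line (3 * x - 2) = 0" | "cantor_line (3 * x) = 1"
      using cantor_line_left[of "3 * x - 2"] cantor_line_right[of "3 * x"] by fastforce
    then show ?case
      unfolding c(1) using double IH c(2) by cases (intro conjI; linarith)+
  qed
  then have "- cantor_line x \<le> B / 2 ^ n" "cantor_line x - 1 \<le> B / 2 ^ n" for n
    by (smt (verit))+
  then have "- cantor_line x \<le> 0" "cantor_line x - 1 \<le> 0"
    by (blast intro: nonpos_if_le_halvings)+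
  then show "0 \<le> cantor_line x" "cantor_line x \<le> 1" by simp_all
qed

text \<open>
  The same halving, now for the largest possible decrease of the function: two points on the same
  side of 2/3 or of 1/3 see only one varying summand, and points in different outer thirds are separated
  by the value 1/2.
\<close>
lemma mono_cantor_line: "x \<le> y \<Longrightarrow> cantor_line x \<le> cantor_line y"
proof -
  have *: "cantor_line x - cantor_line y \<le> 1 / 2 ^ n" if "x \<le> y" for n x y
    using that
  proof (induction n arbitrary: x y)
    case 0
    then show ?case
      using cantor_line_le_one[of x] cantor_line_nonneg[of y] by simp
  next
    case (Suc n)
    define c :: real where "c = 1 / 2 ^ n"
    have le: "1 / 2 ^ Suc n = c / 2" "0 \<le> c" by (simp_all add: c_def)
    have IH: "cantor_line (3 * x) - cantor_line (3 * y) \<le> c"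
      "cantor_line (3 * x - 2) - cantor_line (3 * y - 2) \<le> c"
      using Suc by (simp_all add: c_def)
    consider "y \<le> 2/3" | "1/3 \<le> x" | "x \<le> 1/3" "2/3 \<le> y" by linarith
    then show ?case
    proof cases
      case 1
      then have "cantor_line (3 * x - 2) = 0" "cantor_line (3 * y - 2) = 0"
        using \<open>x \<le> y\<close> by (simp_all add: cantor_line_left)
      then show ?thesis
        using cantor_line_rescale[of x] cantor_line_rescale[of y] IH(1) unfolding le(1) by simp
    next
      case 2
      then have "cantor_line (3 * x) = 1" "cantor_line (3 * y) = 1"
        using \<open>x \<le> y\<close> by (simp_all add: cantor_line_right)
      then show ?thesis
        using cantor_line_rescale[of x] cantor_line_rescale[of y] IH(2) unfolding le(1) by simp
    next
      case 3
      then have "cantor_line (3 * x - 2) = 0" "cantor_line (3 * y) = 1"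
        by (simp_all add: cantor_line_left cantor_line_right)
      then have "2 * cantor_line x = cantor_line (3 * x)"
        "2 * cantor_line y = 1 + cantor_line (3 * y - 2)"
        using cantor_line_rescale[of x] cantor_line_rescale[of y] by simp_all
      then show ?thesis
        using le cantor_line_le_one[of "3 * x"] cantor_line_nonneg[of "3 * y - 2"] by linarith
    qed
  qed
  assume "x \<le> y"
  then have "cantor_line x - cantor_line y \<le> 0"
    using * by (blast intro: nonpos_if_le_halvings)
  then show ?thesis by simp
qed

section \<open>Increments over plateaus\<close>

text \<open>
  By monotonicity the function is constant on \<open>[x, x + \<epsilon>]\<close> for \<open>x\<close> in this set. The margin \<open>\<epsilon>\<close> at both
  ends keeps every \<open>x - h\<close> with \<open>\<bar>h\<bar> \<le> \<epsilon>\<close> inside \<open>[0, 1]\<close>.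
\<close>
definition plateau :: "real \<Rightarrow> real set" where
  "plateau \<epsilon> = {x \<in> {\<epsilon>..1 - \<epsilon>}. cantor_line (x + \<epsilon>) = cantor_line x}"

lemma sets_plateau [measurable]: "plateau \<epsilon> \<in> sets borel"
  unfolding plateau_def by measurable

definition plateau_increment :: "real \<Rightarrow> real \<Rightarrow> real \<Rightarrow> real" where
  "plateau_increment \<epsilon> h x = indicator (plateau \<epsilon>) x * (cantor_line x - cantor_line (x - h))"

lemma borel_measurable_plateau_increment [measurable]:
  "plateau_increment \<epsilon> h \<in> borel_measurable borel"
  unfolding plateau_increment_def[abs_def] by measurable

lemma integrable_on_unit_interval:
  fixes f :: "real \<Rightarrow> real"
  assumes "f \<in> borel_measurable borel" "\<And>x. \<bar>f x\<bar> \<le> B" "\<And>x. x \<notin> {0..1} \<Longrightarrow> f x = 0"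
  shows "integrable lborel f"
proof (rule Bochner_Integration.integrable_bound)
  show "integrable lborel (\<lambda>x :: real. B * indicator {0..1} x)"
    by (intro integrable_mult_right integrable_real_indicator) simp_all
  show "AE x in lborel. norm (f x) \<le> norm (B * indicator {0..1} x)"
  proof (rule AE_I2)
    fix x
    show "norm (f x) \<le> norm (B * indicator {0..1} x)"
      using assms(2)[of x] assms(3)[of x] by (cases "x \<in> {0..1}") auto
  qed
qed (use assms(1) in simp)

lemma integrable_plateau_increment:
  assumes "0 \<le> \<epsilon>"
  shows "integrable lborel (plateau_increment \<epsilon> h)"
proof (rule integrable_on_unit_interval[where B = 1])
  show "\<bar>plateau_increment \<epsilon> h x\<bar> \<le> 1" for x
    using cantor_line_nonneg[of x] cantor_line_le_one[of x]
      cantor_line_nonneg[of "x - h"] cantor_line_le_one[of "x - h"]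
    by (auto simp: plateau_increment_def indicator_def)
  show "plateau_increment \<epsilon> h x = 0" if "x \<notin> {0..1}" for x
    using that assms by (auto simp: plateau_increment_def plateau_def)
qed simp

text \<open>
  If \<open>3 x\<close> or \<open>3 x - 2\<close> lies in \<open>[\<epsilon>, 1 - \<epsilon>]\<close>, then only the corresponding summand of the
  self-similarity varies on \<open>[x, x + \<epsilon> / 3]\<close>; the other one is constantly 0 or 1.
\<close>
lemma plateau_rescale:
  assumes "0 < \<epsilon>" "3 * x \<in> plateau \<epsilon> \<or> 3 * x - 2 \<in> plateau \<epsilon>"
  shows "x \<in> plateau (\<epsilon> / 3)"
  using assms(2)
proof
  assume "3 * x \<in> plateau \<epsilon>"
  then have x: "\<epsilon> \<le> 3 * x" "3 * x \<le> 1 - \<epsilon>" "cantor_line (3 * x + \<epsilon>) = cantor_line (3 * x)"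
    by (auto simp: plateau_def)
  with assms(1) have "cantor_line (3 * x - 2) = 0" "cantor_line (3 * x + \<epsilon> - 2) = 0"
    by (simp_all add: cantor_line_left)
  with x assms(1) show ?thesis
    using cantor_line_rescale[of x] cantor_line_rescale[of "x + \<epsilon> / 3"]
    by (simp add: plateau_def algebra_simps)
next
  assume "3 * x - 2 \<in> plateau \<epsilon>"
  then have x: "\<epsilon> \<le> 3 * x - 2" "3 * x - 2 \<le> 1 - \<epsilon>"
      "cantor_line (3 * x - 2 + \<epsilon>) = cantor_line (3 * x - 2)"
    by (auto simp: plateau_def)
  with assms(1) have "cantor_line (3 * x) = 1" "cantor_line (3 * x + \<epsilon>) = 1"
    by (simp_all add: cantor_line_right)
  with x assms(1) show ?thesis
    using cantor_line_rescale[of x] cantor_line_rescale[of "x + \<epsilon> / 3"]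
    by (simp add: plateau_def algebra_simps)
qed

lemma plateau_increment_rescale:
  assumes "0 < \<epsilon>" "0 \<le> h"
  shows "(plateau_increment \<epsilon> h (3 * x) + plateau_increment \<epsilon> h (3 * x - 2)) / 2
    \<le> plateau_increment (\<epsilon> / 3) (h / 3) x"
proof -
  define D1 where "D1 = cantor_line (3 * x) - cantor_line (3 * x - h)"
  define D2 where "D2 = cantor_line (3 * x - 2) - cantor_line (3 * x - 2 - h)"
  have D: "0 \<le> D1" "0 \<le> D2" 
    using assms by (simp_all add: D1_def D2_def mono_cantor_line)
  have "cantor_line x - cantor_line (x - h / 3) = (D1 + D2) / 2"
    using cantor_line_rescale[of x] cantor_line_rescale[of "x - h / 3"]
    by (simp add: D1_def D2_def right_diff_distrib Groups.diff_right_commute[of _ h])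
  moreover have "plateau_increment \<epsilon> h (3 * x) \<le> D1" "plateau_increment \<epsilon> h (3 * x - 2) \<le> D2"
    using D by (simp_all add: plateau_increment_def D1_def D2_def indicator_def)
  moreover have "plateau_increment \<epsilon> h (3 * x) = 0" "plateau_increment \<epsilon> h (3 * x - 2) = 0"
    if "x \<notin> plateau (\<epsilon> / 3)"
    using plateau_rescale[OF assms(1), of x] that by (auto simp: plateau_increment_def indicator_def)
  ultimately show ?thesis
    by (cases "x \<in> plateau (\<epsilon> / 3)") (simp_all add: plateau_increment_def[of "\<epsilon> / 3"])
qed

text \<open>
  Each of the two shrunk copies has a third of the integral, and the increments are halved.
\<close>
lemma integral_plateau_increment_rescale:
  assumes "0 < \<epsilon>" "0 \<le> h"
  shows "(\<integral>x. plateau_increment \<epsilon> h x \<partial>lborel) / 3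
    \<le> (\<integral>x. plateau_increment (\<epsilon> / 3) (h / 3) x \<partial>lborel)"
proof -
  let ?f = "plateau_increment \<epsilon> h"
  have int: "integrable lborel ?f"
    using assms by (intro integrable_plateau_increment) simp
  have left: "integrable lborel (\<lambda>x. ?f (3 * x))"
    using lborel_integrable_real_affine[OF int, of 3 0] by simp
  have right: "integrable lborel (\<lambda>x. ?f (3 * x - 2))"
    using lborel_integrable_real_affine[OF int, of 3 "-2"] by simp
  have "(\<integral>x. ?f x \<partial>lborel) / 3
      = ((\<integral>x. ?f (3 * x) \<partial>lborel) + (\<integral>x. ?f (3 * x - 2) \<partial>lborel)) / 2"
    using lborel_integral_real_affine[of 3 ?f 0] lborel_integral_real_affine[of 3 ?f "-2"]
    by simp
  also have "\<dots> = (\<integral>x. (?f (3 * x) + ?f (3 * x - 2)) / 2 \<partial>lborel)"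
    using left right by simp
  also have "\<dots> \<le> (\<integral>x. plateau_increment (\<epsilon> / 3) (h / 3) x \<partial>lborel)"
    using left right assms
    by (intro integral_mono integrable_plateau_increment plateau_increment_rescale) auto
  finally show ?thesis .
qed

text \<open>
  On the left half \<open>[1/3, 1/2]\<close> of the middle gap the value is 1/2, and it is at most 7/16 at points
  up to \<open>26/81 = 1/3 - 1/81\<close>. So for \<open>x\<close> in \<open>[1/3, h + 26/81]\<close> the increment is at least 1/16, and
  \<open>(h - 1/81) / 16 \<ge> h / 36\<close> holds for \<open>h \<ge> 1/45\<close>, in particular for \<open>h \<ge> 3/4 * 1/18\<close>.
\<close>
lemma integral_plateau_increment_ge_coarse:
  assumes "1/18 \<le> \<epsilon>" "\<epsilon> < 1/6" "3 * \<epsilon> / 4 \<le> h" "h \<le> \<epsilon>"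
  shows "h / 36 \<le> (\<integral>x. plateau_increment \<epsilon> h x \<partial>lborel)"
proof -
  have mid: "cantor_line x = 1/2" if "1/3 \<le> x" "x \<le> 2/3" for x
    using that cantor_line_rescale[of x] by (simp add: cantor_line_left cantor_line_right)
  have "cantor_line (8/9) = 3/4"
    using cantor_line_rescale[of "8/9"] mid[of "2/3"] by (simp add: cantor_line_right)
  then have "cantor_line (26/27) = 7/8"
    using cantor_line_rescale[of "26/27"] by (simp add: cantor_line_right)
  then have v: "cantor_line (26/81) = 7/16"
    using cantor_line_rescale[of "26/81"] by (simp add: cantor_line_left)
  have ptw: "1/16 * indicator {1/3..h + 26/81} x \<le> plateau_increment \<epsilon> h x" for x
  proof (cases "x \<in> {1/3..h + 26/81}")
    case True
    then have "x \<in> plateau \<epsilon>" "cantor_line x = 1/2"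
      using assms by (auto simp: plateau_def mid)
    moreover have "cantor_line (x - h) \<le> 7/16"
      using True mono_cantor_line[of "x - h" "26/81"] v by simp
    ultimately show ?thesis using True by (simp add: plateau_increment_def)
  next
    case False
    then show ?thesis
      using mono_cantor_line[of "x - h" x] assms by (simp add: plateau_increment_def)
  qed
  have "h / 36 \<le> 1/16 * (h - 1/81)"
    using assms by simp
  also have "\<dots> = (\<integral>x. 1/16 * indicator {1/3..h + 26/81} x \<partial>lborel)"
    using assms by simp
  also have "\<dots> \<le> (\<integral>x. plateau_increment \<epsilon> h x \<partial>lborel)"
    using assms ptw by (intro integral_mono integrable_plateau_increment) auto
  finally show ?thesis .
qed

lemma integral_plateau_increment_ge:
  assumes "0 < \<epsilon>" "\<epsilon> < 1/6" "3 * \<epsilon> / 4 \<le> h" "h \<le> \<epsilon>"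
  shows "h / 36 \<le> (\<integral>x. plateau_increment \<epsilon> h x \<partial>lborel)"
proof -
  obtain n where "1/18 / \<epsilon> < 3 ^ n"
    using real_arch_pow[of 3 "1/18 / \<epsilon>"] by auto
  with assms(1) have "1/18 \<le> 3 ^ n * \<epsilon>" by (simp add: field_simps)
  then show ?thesis
    using assms
  proof (induction n arbitrary: \<epsilon> h)
    case 0
    then show ?case by (intro integral_plateau_increment_ge_coarse) auto
  next
    case (Suc n)
    show ?case
    proof (cases "1/18 \<le> \<epsilon>")
      case True
      with Suc.prems show ?thesis by (intro integral_plateau_increment_ge_coarse) auto
    next
      case False
      have "(3 * h) / 36 \<le> (\<integral>x. plateau_increment (3 * \<epsilon>) (3 * h) x \<partial>lborel)"
        using Suc.prems False by (intro Suc.IH) auto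
      then show ?thesis
        using integral_plateau_increment_rescale[of "3 * \<epsilon>" "3 * h"] Suc.prems by simp
    qed
  qed
qed

section \<open>Integrability of the difference quotient\<close>

text \<open>
  After translating the second term, the two integrals run over \<open>[0, 1]\<close> and \<open>[-h, 1 - h]\<close>. They cancel
  on the common part, and the positive part of what remains lives on \<open>[1 - h, 1]\<close>, where the
  function is at most 1.
\<close>
lemma integral_cantor_shift_le:
  assumes "0 \<le> h"
  shows "(\<integral>x. indicator {0..1} x * (cantor_line x - cantor_line (x - h)) \<partial>lborel) \<le> h"
proof -
  let ?v = cantor_line
  have int: "integrable lborel (\<lambda>x. indicator {a..b} x * ?v (x - t))" for a b t
    using borel_integrable_compact[of "{a..b}" "\<lambda>x. ?v (x - t)"]
    by (simp add: continuous_on_compose2[OF continuous_cantor_line[of UNIV]] continuous_intros)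
  note int0 = int[where t = 0, simplified]
  have shift: "(\<integral>x. indicator {0..1} x * ?v (x - h) \<partial>lborel)
      = (\<integral>x. indicator {-h..1 - h} x * ?v x \<partial>lborel)"
  proof -
    have "(\<integral>x. indicator {0..1} x * ?v (x - h) \<partial>lborel)
        = (\<integral>x. indicator {0..1} (h + x) * ?v x \<partial>lborel)"
      using lborel_integral_real_affine[of 1 "\<lambda>x. indicator {0..1} x * ?v (x - h)" h] by simp
    also have "(\<lambda>x. indicator {0..1} (h + x) * ?v x) = (\<lambda>x. indicator {-h..1 - h} x * ?v x)"
      by (auto simp: fun_eq_iff indicator_def)
    finally show ?thesis .
  qed
  have ptw: "indicator {0..1} x * ?v x - indicator {-h..1 - h} x * ?v x \<le> indicator {1 - h..1} x" for x
    using assms cantor_line_nonneg[of x] cantor_line_le_one[of x] by (auto simp: indicator_def)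
  have "(\<integral>x. indicator {0..1} x * (?v x - ?v (x - h)) \<partial>lborel)
      = (\<integral>x. indicator {0..1} x * ?v x \<partial>lborel) - (\<integral>x. indicator {0..1} x * ?v (x - h) \<partial>lborel)"
    using int int0 by (simp add: right_diff_distrib)
  also have "\<dots> = (\<integral>x. indicator {0..1} x * ?v x - indicator {-h..1 - h} x * ?v x \<partial>lborel)"
    using int0 by (simp add: shift)
  also have "\<dots> \<le> (\<integral>x. indicator {1 - h..1} x \<partial>lborel)"
    using int0 ptw by (intro integral_mono integrable_real_indicator) (use assms in simp_all)
  also have "\<dots> = h"
    using assms by simp
  finally show ?thesis .
qed

text \<open>
  The difference quotient of the theorem in the coordinates \<open>x\<close> and \<open>h = x - y\<close>. Both indicators are
  part of the kernel so that all integrals run over the whole line.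
\<close>
definition cantor_quotient :: "real \<Rightarrow> real \<Rightarrow> real" where
  "cantor_quotient h x
    = indicator {0..1} x * indicator {0..1} (x - h) * ((cantor_line x - cantor_line (x - h)) / \<bar>h\<bar>)"

lemma integrable_cantor_quotient: "integrable lborel (cantor_quotient h)"
proof (rule integrable_on_unit_interval[where B = "1 / \<bar>h\<bar>"])
  show "cantor_quotient h \<in> borel_measurable borel"
    unfolding cantor_quotient_def[abs_def] by measurable
  show "\<bar>cantor_quotient h x\<bar> \<le> 1 / \<bar>h\<bar>" for x
    using cantor_line_nonneg[of x] cantor_line_le_one[of x]
      cantor_line_nonneg[of "x - h"] cantor_line_le_one[of "x - h"]
    by (auto simp: cantor_quotient_def indicator_def intro!: divide_right_mono)
qed (simp add: cantor_quotient_def)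

lemma integral_abs_cantor_quotient_le: "(\<integral>x. \<bar>cantor_quotient h x\<bar> \<partial>lborel) \<le> 1"
proof -
  let ?d = "\<lambda>t x. indicator {0..1} x * (cantor_line x - cantor_line (x - t))"
  have int: "integrable lborel (?d t)" for t
  proof (rule integrable_on_unit_interval[where B = 1])
    show "\<bar>?d t x\<bar> \<le> 1" for x
      using cantor_line_nonneg[of x] cantor_line_le_one[of x]
        cantor_line_nonneg[of "x - t"] cantor_line_le_one[of "x - t"] by (auto simp: indicator_def)
  qed auto
  have int': "integrable lborel (\<lambda>x. ?d t (x + s))" for t s
    using lborel_integrable_real_affine[OF int[of t], of 1 s] by (simp add: add.commute)
  consider "h = 0" | "0 < h" | "h < 0" by linarith
  then show ?thesis
  proof cases
    case 1
    then show ?thesis by (simp add: cantor_quotient_def)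
  next
    case 2
    have "\<bar>cantor_quotient h x\<bar> \<le> ?d h x / h" for x
      using 2 mono_cantor_line[of "x - h" x] by (simp add: cantor_quotient_def indicator_def)
    then have "(\<integral>x. \<bar>cantor_quotient h x\<bar> \<partial>lborel) \<le> (\<integral>x. ?d h x / h \<partial>lborel)"
      using int by (intro integral_mono integrable_abs integrable_cantor_quotient) auto
    also have "\<dots> \<le> 1"
      using integral_cantor_shift_le[of h] 2 by simp
    finally show ?thesis .
  next
    case 3
    \<comment> \<open>Exchange the roles of the two points: \<open>x = (x - h) - (- h)\<close>.\<close>
    have "\<bar>cantor_quotient h x\<bar> \<le> ?d (- h) (x + - h) / - h" for x
      using 3 mono_cantor_line[of x "x - h"]
      by (auto simp: cantor_quotient_def indicator_def abs_if divide_simps)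
    then have "(\<integral>x. \<bar>cantor_quotient h x\<bar> \<partial>lborel) \<le> (\<integral>x. ?d (- h) (x + - h) / - h \<partial>lborel)"
      using int'[of "- h" "- h"]
      by (intro integral_mono integrable_abs integrable_cantor_quotient integrable_divide) auto
    also have "\<dots> = (\<integral>x. ?d (- h) (x + - h) \<partial>lborel) / - h"
      by (rule integral_divide_zero)
    also have "(\<integral>x. ?d (- h) (x + - h) \<partial>lborel) = (\<integral>x. ?d (- h) x \<partial>lborel)"
      using lborel_integral_real_affine[of 1 "?d (- h)" "- h"] by (simp add: add.commute)
    also have "\<dots> / - h \<le> 1"
      using integral_cantor_shift_le[of "- h"] 3 by (simp add: divide_simps)
    finally show ?thesis .
  qed
qed

lemma integrable_cantor_quotient_kernel:
  assumes "integrable lborel g"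
  shows "integrable (lborel \<Otimes>\<^sub>M lborel) (\<lambda>(h, x). cantor_quotient h x * g h)"
proof -
  have [measurable]: "g \<in> borel_measurable borel"
    using borel_measurable_integrable[OF assms] by simp
  show ?thesis
  proof (rule lborel_pair.Fubini_integrable)
    show "(\<lambda>(h, x). cantor_quotient h x * g h) \<in> borel_measurable (lborel \<Otimes>\<^sub>M lborel)"
      unfolding cantor_quotient_def by measurable
    have eq: "(\<integral>x. norm (case (h, x) of (h, x) \<Rightarrow> cantor_quotient h x * g h) \<partial>lborel)
        = (\<integral>x. \<bar>cantor_quotient h x\<bar> \<partial>lborel) * \<bar>g h\<bar>" for h
      by (simp add: abs_mult)
    show "integrable lborel
        (\<lambda>h. \<integral>x. norm (case (h, x) of (h, x) \<Rightarrow> cantor_quotient h x * g h) \<partial>lborel)"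
      unfolding eq
    proof (rule Bochner_Integration.integrable_bound[OF integrable_abs[OF assms]])
      show "AE h in lborel. norm ((\<integral>x. \<bar>cantor_quotient h x\<bar> \<partial>lborel) * \<bar>g h\<bar>) \<le> norm \<bar>g h\<bar>"
      proof (rule AE_I2)
        fix h
        show "norm ((\<integral>x. \<bar>cantor_quotient h x\<bar> \<partial>lborel) * \<bar>g h\<bar>) \<le> norm \<bar>g h\<bar>"
          using integral_abs_cantor_quotient_le[of h]
          by (simp add: abs_mult mult_left_le_one_le)
      qed
    next
      show "(\<lambda>h. (\<integral>x. \<bar>cantor_quotient h x\<bar> \<partial>lborel) * \<bar>g h\<bar>) \<in> borel_measurable lborel"
        unfolding cantor_quotient_def by measurable
    qed
    show "AE h in lborel. integrable lborel (\<lambda>x. case (h, x) of (h, x) \<Rightarrow> cantor_quotient h x * g h)"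
      using integrable_cantor_quotient by simp
  qed
qed

section \<open>The lower bound\<close>

text \<open>
  The theorem for a density that is nonnegative and supported in \<open>[- \<epsilon>, \<epsilon>]\<close> everywhere, not merely
  almost everywhere: discard the absolute value and all \<open>x\<close> outside the plateau set, exchange the
  integrals, and estimate the integral over \<open>x\<close> for each \<open>h\<close> separately.
\<close>
lemma plateau_quotient_lower_bound:
  assumes g: "integrable lborel g" "\<And>h. 0 \<le> g h" "\<And>h. h \<notin> {- \<epsilon>..\<epsilon>} \<Longrightarrow> g h = 0"
    and \<epsilon>: "0 < \<epsilon>" "\<epsilon> < 1/6"
  shows "1/36 * (\<integral>h. indicator {3 * \<epsilon> / 4..\<epsilon>} h * g h \<partial>lborel)
    \<le> (\<integral>x. \<bar>\<integral>h. cantor_quotient h x * g h \<partial>lborel\<bar> \<partial>lborel)"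
proof -
  let ?P = "indicator (plateau \<epsilon>) :: real \<Rightarrow> real"
  let ?K = "\<lambda>h x. cantor_quotient h x * g h"
  have [measurable]: "g \<in> borel_measurable borel"
    using borel_measurable_integrable[OF g(1)] by simp
  note K = integrable_cantor_quotient_kernel[OF g(1)]
  have PK: "integrable (lborel \<Otimes>\<^sub>M lborel) (\<lambda>(h, x). ?P x * ?K h x)"
  proof (rule Bochner_Integration.integrable_bound[OF K])
    show "(\<lambda>(h, x). ?P x * ?K h x) \<in> borel_measurable (lborel \<Otimes>\<^sub>M lborel)"
      unfolding cantor_quotient_def by measurable
    show "AE p in lborel \<Otimes>\<^sub>M lborel. norm (case p of (h, x) \<Rightarrow> ?P x * ?K h x)
        \<le> norm (case p of (h, x) \<Rightarrow> ?K h x)"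
      by (auto simp: indicator_def)
  qed
  have ptw: "1/36 * (indicator {3 * \<epsilon> / 4..\<epsilon>} h * g h) \<le> (\<integral>x. ?P x * ?K h x \<partial>lborel)" for h
  proof (cases "h \<in> {3 * \<epsilon> / 4..\<epsilon>}")
    case True
    then have h: "0 < h" "3 * \<epsilon> / 4 \<le> h" "h \<le> \<epsilon>" using \<epsilon> by auto
    have eq: "?P x * ?K h x = plateau_increment \<epsilon> h x * (g h / h)" for x
      using h by (auto simp: plateau_increment_def cantor_quotient_def plateau_def indicator_def)
    have "1/36 * g h = (h / 36) * (g h / h)"
      using h by simp
    also have "\<dots> \<le> (\<integral>x. plateau_increment \<epsilon> h x \<partial>lborel) * (g h / h)"
      using integral_plateau_increment_ge[OF \<epsilon> h(2,3)] g(2) h by (intro mult_right_mono) auto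
    also have "\<dots> = (\<integral>x. ?P x * ?K h x \<partial>lborel)"
      unfolding eq by simp
    finally show ?thesis using True by simp
  next
    case False
    \<comment> \<open>On the plateau set, a negative \<open>h\<close> leads to a point with the same value, a positive one to a
        point with a smaller or equal value.\<close>
    have "0 \<le> ?P x * ?K h x" for x
    proof (cases "x \<in> plateau \<epsilon> \<and> h \<in> {- \<epsilon>..\<epsilon>}")
      case True
      then have "cantor_line (x - h) \<le> cantor_line (x + \<epsilon>)"
        by (intro mono_cantor_line) auto
      with True show ?thesis
        using g(2)[of h] by (auto simp: cantor_quotient_def plateau_def indicator_def)
    next
      case False
      then show ?thesis using g(3)[of h] by (auto simp: indicator_def)
    qed
    then have "0 \<le> (\<integral>x. ?P x * ?K h x \<partial>lborel)"
      by (intro Bochner_Integration.integral_nonneg) auto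
    with False show ?thesis by simp
  qed
  have g': "integrable lborel (\<lambda>h. indicator {3 * \<epsilon> / 4..\<epsilon>} h * g h)"
    using integrable_mult_indicator[OF _ g(1), of "{3 * \<epsilon> / 4..\<epsilon>}"] by simp
  have "1/36 * (\<integral>h. indicator {3 * \<epsilon> / 4..\<epsilon>} h * g h \<partial>lborel)
      = (\<integral>h. 1/36 * (indicator {3 * \<epsilon> / 4..\<epsilon>} h * g h) \<partial>lborel)"
    by simp
  also have "\<dots> \<le> (\<integral>h. (\<integral>x. ?P x * ?K h x \<partial>lborel) \<partial>lborel)"
    using g' lborel_pair.integrable_fst'[OF PK] ptw by (intro integral_mono) auto
  also have "\<dots> = (\<integral>x. (\<integral>h. ?P x * ?K h x \<partial>lborel) \<partial>lborel)"
    by (rule lborel_pair.Fubini_integral[OF PK, symmetric])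
  also have "\<dots> \<le> (\<integral>x. \<bar>\<integral>h. ?K h x \<partial>lborel\<bar> \<partial>lborel)"
  proof (rule integral_mono)
    show "integrable lborel (\<lambda>x. \<integral>h. ?P x * ?K h x \<partial>lborel)"
      by (rule lborel_pair.integrable_snd[OF PK])
    show "integrable lborel (\<lambda>x. \<bar>\<integral>h. ?K h x \<partial>lborel\<bar>)"
      by (intro integrable_abs lborel_pair.integrable_snd[OF K])
    show "(\<integral>h. ?P x * ?K h x \<partial>lborel) \<le> \<bar>\<integral>h. ?K h x \<partial>lborel\<bar>" for x
      by (cases "x \<in> plateau \<epsilon>") auto
  qed
  finally show ?thesis .
qed

section \<open>From Lebesgue measurable to Borel measurable densities\<close>

text \<open>
  The complement of the essential support is a union of possibly uncountably many open sets on
  each of which the function vanishes almost everywhere; by the Lindelof property countably many of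
  them suffice.
\<close>
lemma AE_essential_support: "AE x in lebesgue. x \<notin> essential_support f \<longrightarrow> f x = 0"
proof -
  define \<U> where "\<U> = {U. open U \<and> (AE x in lebesgue. x \<in> U \<longrightarrow> f x = 0)}"
  obtain \<U>' where U: "\<U>' \<subseteq> \<U>" "countable \<U>'" "\<Union>\<U>' = \<Union>\<U>"
    using Lindelof[of \<U>] by (auto simp: \<U>_def)
  have "AE x in lebesgue. \<forall>U\<in>\<U>'. x \<in> U \<longrightarrow> f x = 0"
    using U by (subst AE_ball_countable) (auto simp: \<U>_def)
  then show ?thesis
  proof eventually_elim
    case (elim x)
    have "x \<in> \<Union>\<U>'" if "x \<notin> essential_support f"
      using that by (simp only: U(3)) (auto simp: essential_support_def \<U>_def)
    with elim show ?case by blast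
  qed
qed

lemma lebesgue_integral_eq_lborel:
  fixes f g :: "real \<Rightarrow> real"
  assumes "g \<in> borel_measurable borel" "AE x in lebesgue. f x = g x"
  shows "integral\<^sup>L lebesgue f = integral\<^sup>L lborel g"
proof -
  have g: "g \<in> borel_measurable lebesgue"
    using assms(1) by (simp add: measurable_completion)
  have "f \<in> borel_measurable lebesgue"
    using assms(2) by (intro borel_measurable_AE[OF g]) (auto simp: eq_commute)
  then have "integral\<^sup>L lebesgue f = integral\<^sup>L lebesgue g"
    using g assms(2) by (rule integral_cong_AE)
  also have "\<dots> = integral\<^sup>L lborel g"
    using assms(1) by (simp add: integral_completion)
  finally show ?thesis .
qed

text \<open>
  Product measures of \<open>lborel\<close> only see Borel functions, so a Lebesgue integrable density is replaced by
  a Borel function that moreover has its sign and support properties at every point.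
\<close>
lemma borel_representative:
  fixes \<rho> :: "real \<Rightarrow> real"
  assumes "integrable lebesgue \<rho>" "AE x in lebesgue. 0 \<le> \<rho> x"
    and "closed S" "essential_support \<rho> \<subseteq> S"
  obtains g where "integrable lborel g" "AE x in lebesgue. \<rho> x = g x"
    "\<And>x. 0 \<le> g x" "\<And>x. x \<notin> S \<Longrightarrow> g x = 0"
proof -
  obtain g0 where g0 [measurable]: "g0 \<in> borel_measurable borel" and eq: "AE x in lebesgue. \<rho> x = g0 x"
    using completion_ex_borel_measurable_real[OF borel_measurable_integrable[OF assms(1)]]
    by (auto simp: AE_completion_iff)
  define g where "g x = indicator S x * max 0 (g0 x)" for x
  have [measurable]: "S \<in> sets borel" using assms(3) by simp
  have g [measurable]: "g \<in> borel_measurable borel"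
    unfolding g_def[abs_def] by measurable
  have ae: "AE x in lebesgue. \<rho> x = g x"
    using eq assms(2) AE_essential_support[of \<rho>]
    by eventually_elim (use assms(4) in \<open>auto simp: g_def indicator_def\<close>)
  have "integrable lebesgue g"
    using assms(1) ae g
    by (subst integrable_cong_AE[of _ _ \<rho>]) (auto simp: measurable_completion eq_commute)
  then have "integrable lborel g"
    using g by (simp add: integrable_completion)
  then show thesis
    using ae by (rule that) (auto simp: g_def)
qed

theorem proposition4p1:
  fixes u \<rho> :: "real \<Rightarrow> real" and \<epsilon> :: real
  assumes "u = cantor_function"
    and "0 < \<epsilon>" "\<epsilon> < 1/6"
    and "integrable lebesgue \<rho>"
    and "AE x in lebesgue. 0 \<le> \<rho> x"
    and "AE x in lebesgue. \<rho> (- x) = \<rho> x"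
    and "essential_support \<rho> \<subseteq> {- \<epsilon>..\<epsilon>}"
  shows "(LINT x:{0..1}|lebesgue. \<bar>LINT y:{0..1}|lebesgue. (u x - u y) / \<bar>x - y\<bar> * \<rho> (x - y)\<bar>)
           \<ge> 1/36 * (LINT x:{3 * \<epsilon> / 4..\<epsilon>}|lebesgue. \<rho> x)"
proof -
  obtain g where g: "integrable lborel g" "AE x in lebesgue. \<rho> x = g x"
      "\<And>x. 0 \<le> g x" "\<And>x. x \<notin> {- \<epsilon>..\<epsilon>} \<Longrightarrow> g x = 0"
    using borel_representative[OF assms(4,5) _ assms(7)] by auto
  have [measurable]: "g \<in> borel_measurable borel"
    using borel_measurable_integrable[OF g(1)] by simp
  define F where "F x = (\<integral>h. cantor_quotient h x * g h \<partial>lborel)" for x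
  have F [measurable]: "F \<in> borel_measurable borel"
    using borel_measurable_integrable[OF lborel_pair.integrable_snd[OF
        integrable_cantor_quotient_kernel[OF g(1)]]]
    by (simp add: F_def[abs_def])
  have inner: "(LINT y:{0..1}|lebesgue. (u x - u y) / \<bar>x - y\<bar> * \<rho> (x - y)) = F x"
    if x: "x \<in> {0..1}" for x
  proof -
    let ?f = "\<lambda>y. indicator {0..1} y * ((u x - u y) / \<bar>x - y\<bar> * \<rho> (x - y))"
    \<comment> \<open>Substituting before \<open>\<rho>\<close> is replaced leaves \<open>\<rho> h\<close>, where the almost everywhere equality with
        \<open>g\<close> applies directly.\<close>
    have "integral\<^sup>L lebesgue ?f = integral\<^sup>L lebesgue (\<lambda>h. ?f (x - h))"
      using lebesgue_integral_real_affine[of "-1" ?f x] by simp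
    also have "\<dots> = F x"
      unfolding F_def
    proof (rule lebesgue_integral_eq_lborel)
      show "(\<lambda>h. cantor_quotient h x * g h) \<in> borel_measurable borel"
        unfolding cantor_quotient_def by measurable
      show "AE h in lebesgue. ?f (x - h) = cantor_quotient h x * g h"
        using g(2)
      proof eventually_elim
        case (elim h)
        show ?case
          using x elim by (cases "x - h \<in> {0..1}")
            (simp_all add: assms(1) cantor_quotient_def cantor_line_eq indicator_def)
      qed
    qed
    finally show ?thesis by (simp add: set_lebesgue_integral_def)
  qed
  have F0: "F x = 0" if "x \<notin> {0..1}" for x
    using that by (simp add: F_def cantor_quotient_def)
  have "(LINT x:{0..1}|lebesgue. \<bar>LINT y:{0..1}|lebesgue. (u x - u y) / \<bar>x - y\<bar> * \<rho> (x - y)\<bar>)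
      = (\<integral>x. \<bar>F x\<bar> \<partial>lborel)"
    unfolding set_lebesgue_integral_def[of _ _ "\<lambda>x. \<bar>_ x\<bar>"]
  proof (rule lebesgue_integral_eq_lborel)
    show "AE x in lebesgue. indicator {0..1} x *\<^sub>R
        \<bar>LINT y:{0..1}|lebesgue. (u x - u y) / \<bar>x - y\<bar> * \<rho> (x - y)\<bar> = \<bar>F x\<bar>"
      using inner F0 by (intro AE_I2) (simp add: indicator_def)
  qed measurable
  moreover have "(LINT x:{3 * \<epsilon> / 4..\<epsilon>}|lebesgue. \<rho> x)
      = (\<integral>h. indicator {3 * \<epsilon> / 4..\<epsilon>} h * g h \<partial>lborel)"
    unfolding set_lebesgue_integral_def
    by (rule lebesgue_integral_eq_lborel) (use g(2) in \<open>auto elim: eventually_mono\<close>)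
  ultimately show ?thesis
    using plateau_quotient_lower_bound[OF g(1,3,4) assms(2,3)] by (simp add: F_def)
qed

end
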